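(* Every graph in $\varepsilon_{12}$ has a node of degree $2$.
   Context: All graphs are finite, simple and connected. An Euler graph is a connected graph all of whose nodes have even degree. A cycle of length $n$ is of type $i$ if $n\equiv i\pmod 4$. $\varepsilon_{12}$ is the class of Euler graphs in which every cycle has length $\equiv 1$ or $\equiv 2\pmod 4$ and which contain at least one cycle of each of the types $1$ and $2$. *)

theory Defs
  imports "Graph_Theory.Graph_Theory"
begin

text \<open>
  A finite simple graph is a \<^locale>\<open>graph\<close>: a finite symmetric digraph without loops and
  without parallel arcs, each undirected edge being a pair of opposite arcs. Hence the degree of a
  node is its \<^const>\<open>out_degree\<close>. The bound on the length excludes the closed walks
  \<open>u, v, u\<close> along a single undirected edge, which \<^const>\<open>pre_digraph.cycle\<close> admits.
\<close>

definition ucycle :: "('a, 'b) pre_digraph \<Rightarrow> 'b list \<Rightarrow> bool" where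
  "ucycle G p \<longleftrightarrow> pre_digraph.cycle G p \<and> 3 \<le> length p"

definition cycle_of_type :: "('a, 'b) pre_digraph \<Rightarrow> nat \<Rightarrow> 'b list \<Rightarrow> bool" where
  "cycle_of_type G i p \<longleftrightarrow> ucycle G p \<and> length p mod 4 = i mod 4"

definition euler_graph :: "('a, 'b) pre_digraph \<Rightarrow> bool" where
  "euler_graph G \<longleftrightarrow> graph G \<and> connected G \<and> (\<forall>v \<in> verts G. even (out_degree G v))"

definition epsilon12 :: "('a, 'b) pre_digraph set" where
  "epsilon12 = {G. euler_graph G
     \<and> (\<forall>p. ucycle G p \<longrightarrow> cycle_of_type G 1 p \<or> cycle_of_type G 2 p)
     \<and> (\<exists>p. cycle_of_type G 1 p)
     \<and> (\<exists>p. cycle_of_type G 2 p)}"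

end

theory Submission
  imports Defs
begin

text \<open>
  A cycle with two crossing chords is a subdivision of \<open>K\<^sub>4\<close>, and the lengths of its seven cycles
  cannot all be 1 or 2 modulo 4. On the other hand, minimum degree 3 forces crossing chords. Among
  the longest paths \<open>v\<^sub>0 \<dots> v\<^sub>k\<close> choose one where \<open>v\<^sub>0\<close> has a neighbour \<open>v\<^sub>a\<close> with \<open>a \<ge> 2\<close> least
  possible. All neighbours of \<open>v\<^sub>0\<close> lie on the path, so there is one, \<open>v\<^sub>b\<close>, with \<open>b > a\<close>. The rotated
  path \<open>v\<^bsub>a-1\<^esub> \<dots> v\<^sub>0 v\<^sub>a \<dots> v\<^sub>k\<close> is also longest, hence \<open>v\<^bsub>a-1\<^esub>\<close> has a neighbour \<open>v\<^sub>c\<close> with \<open>c > a\<close>.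
  If \<open>c \<le> b\<close>, the chords \<open>v\<^sub>0v\<^sub>a\<close> and \<open>v\<^bsub>a-1\<^esub>v\<^sub>c\<close> cross in the cycle \<open>v\<^sub>0 \<dots> v\<^sub>b\<close>; otherwise the same
  happens for the rotated path. So a graph in the class has a node of degree at most 2; this degree
  is even, and not 0 because the graph is connected and contains a cycle.
\<close>

subsection \<open>Vertex walks and vertex cycles\<close>

lemma vwalk_append_iff:
  assumes "p \<noteq> []" "q \<noteq> []"
  shows "vwalk (p @ q) G \<longleftrightarrow> vwalk p G \<and> vwalk q G \<and> last p \<rightarrow>\<^bsub>G\<^esub> hd q"
  using assms by (auto simp: vwalk_def vwalk_arcs_append)

lemma vpath_append_iff:
  assumes "p \<noteq> []" "q \<noteq> []"
  shows "vpath (p @ q) G \<longleftrightarrow> vpath p G \<and> vpath q G \<and> set p \<inter> set q = {} \<and> last p \<rightarrow>\<^bsub>G\<^esub> hd q"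
  using assms by (auto simp: vpath_def vwalk_append_iff)

lemma vpath_singleton_iff: "vpath [v] G \<longleftrightarrow> v \<in> verts G"
  by (auto simp: vpath_def vwalk_def)

lemma vpath_Cons_iff:
  assumes "p \<noteq> []"
  shows "vpath (v # p) G \<longleftrightarrow> v \<in> verts G \<and> vpath p G \<and> v \<notin> set p \<and> v \<rightarrow>\<^bsub>G\<^esub> hd p"
  using assms vpath_append_iff[of "[v]" p G] by (auto simp: vpath_singleton_iff)

lemma (in sym_digraph) dominates_sym: "u \<rightarrow>\<^bsub>G\<^esub> v \<longleftrightarrow> v \<rightarrow>\<^bsub>G\<^esub> u"
  using arcs_ends_symmetric[OF sym_arcs] by blast

lemma (in sym_digraph) vpath_rev_iff: "vpath (rev p) G \<longleftrightarrow> vpath p G"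
  using dominates_sym by (fastforce simp: vpath_def vwalk_def set_vwalk_arcs_rev)

definition rev_prefix :: "nat \<Rightarrow> 'a list \<Rightarrow> 'a list" where
  "rev_prefix n xs = rev (take n xs) @ drop n xs"

lemma length_rev_prefix [simp]: "length (rev_prefix n xs) = length xs"
  by (simp add: rev_prefix_def)

lemma nth_rev_prefix:
  assumes "n \<le> length xs" "i < length xs"
  shows "rev_prefix n xs ! i = (if i < n then xs ! (n - 1 - i) else xs ! i)"
  using assms by (simp add: rev_prefix_def nth_append rev_nth)

lemma (in sym_digraph) vpath_rev_prefix:
  assumes "vpath p G" "n < length p" "p ! 0 \<rightarrow>\<^bsub>G\<^esub> p ! n"
  shows "vpath (rev_prefix n p) G"
proof (cases "n = 0")
  case False
  have nonempty: "take n p \<noteq> []" "drop n p \<noteq> []"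
    using assms(2) False by auto
  moreover have "vpath (take n p @ drop n p) G"
    using assms(1) by simp
  moreover have "last (rev (take n p)) = p ! 0" "hd (drop n p) = p ! n"
    using assms(2) nonempty(1) by (simp_all add: last_rev hd_conv_nth hd_drop_conv_nth)
  ultimately show ?thesis
    using assms(3) unfolding rev_prefix_def by (subst (asm) vpath_append_iff)
      (auto simp: vpath_append_iff vpath_rev_iff)
qed (use assms in \<open>simp add: rev_prefix_def\<close>)

lemma vpath_nth_dominates:
  assumes "vpath p G" "Suc i < length p"
  shows "p ! i \<rightarrow>\<^bsub>G\<^esub> p ! Suc i"
proof -
  have "vpath (take (Suc i) p @ drop (Suc i) p) G"
    using assms(1) by simp
  then have "last (take (Suc i) p) \<rightarrow>\<^bsub>G\<^esub> hd (drop (Suc i) p)"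
    using assms(2) by (subst (asm) vpath_append_iff) auto
  then show ?thesis
    using assms(2) by (simp add: take_Suc_conv_app_nth hd_drop_conv_nth)
qed

definition vcycle :: "'a vwalk \<Rightarrow> ('a, 'b) pre_digraph \<Rightarrow> bool" where
  "vcycle c G \<longleftrightarrow> vpath c G \<and> 3 \<le> length c \<and> last c \<rightarrow>\<^bsub>G\<^esub> hd c"

lemma vcycle_append_commute: "vcycle (p @ q) G \<longleftrightarrow> vcycle (q @ p) G"
  by (cases "p = []"; cases "q = []") (auto simp: vcycle_def vpath_append_iff)

lemma (in wf_digraph) vwalk_imp_awalk:
  assumes "vwalk p G"
  shows "\<exists>es. awalk (hd p) es (last p) \<and> awalk_verts (hd p) es = p"
  using assms
proof (induction rule: vwalk_induct)
  case (Base u)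
  then show ?case by (intro exI[of _ "[]"]) (simp add: awalk_Nil_iff)
next
  case (Cons u v p)
  then obtain es where "awalk v es (last (v # p))" "awalk_verts v es = v # p"
    by auto
  moreover obtain e where "e \<in> arcs G" "tail G e = u" "head G e = v"
    using Cons.hyps(1) by (auto simp: arcs_ends_conv)
  ultimately show ?case
    by (intro exI[of _ "e # es"]) (simp add: awalk_Cons_iff)
qed

lemma (in wf_digraph) vcycle_imp_ucycle:
  assumes "vcycle c G"
  shows "\<exists>es. ucycle G es \<and> length es = length c"
proof -
  have "c \<noteq> []" "distinct c" "3 \<le> length c"
    using assms by (auto simp: vcycle_def)
  have "vwalk [hd c] G"
    using assms adj_in_verts(2) by (auto simp: vcycle_def)
  then have "vwalk (c @ [hd c]) G"
    using assms \<open>c \<noteq> []\<close> by (simp add: vwalk_append_iff vcycle_def vpath_def)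
  then obtain es where awalk_es: "awalk (hd c) es (hd c)" "awalk_verts (hd c) es = c @ [hd c]"
    using vwalk_imp_awalk[of "c @ [hd c]"] \<open>c \<noteq> []\<close> by auto
  have "length es = length c"
    using arg_cong[OF awalk_es(2), of length] by (simp add: length_awalk_verts)
  moreover have "distinct (tl (awalk_verts (hd c) es))"
    using \<open>c \<noteq> []\<close> \<open>distinct c\<close> awalk_es(2) by (cases c) auto
  ultimately show ?thesis
    using \<open>c \<noteq> []\<close> \<open>3 \<le> length c\<close> awalk_es(1)
    by (intro exI[of _ es]) (auto simp: ucycle_def cycle_def)
qed

subsection \<open>Crossing chords\<close>

definition has_crossing_chords :: "'a vwalk \<Rightarrow> ('a, 'b) pre_digraph \<Rightarrow> bool" where
  "has_crossing_chords c G \<longleftrightarrow>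
     (\<exists>i j k l. i < j \<and> j < k \<and> k < l \<and> l < length c \<and> c ! i \<rightarrow>\<^bsub>G\<^esub> c ! k \<and> c ! j \<rightarrow>\<^bsub>G\<^esub> c ! l)"

lemma vcycle_crossing_chordsE:
  assumes "vcycle c G" "has_crossing_chords c G"
  obtains p q r s where "vcycle (p @ q @ r @ s) G" "p \<noteq> []" "q \<noteq> []" "r \<noteq> []" "s \<noteq> []"
    "hd p \<rightarrow>\<^bsub>G\<^esub> hd r" "hd q \<rightarrow>\<^bsub>G\<^esub> hd s"
proof -
  obtain i j k l where indices: "i < j" "j < k" "k < l" "l < length c"
    and chords: "c ! i \<rightarrow>\<^bsub>G\<^esub> c ! k" "c ! j \<rightarrow>\<^bsub>G\<^esub> c ! l"
    using assms(2) by (auto simp: has_crossing_chords_def)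
  define p q r s where "p = drop i (take j c)" and "q = drop j (take k c)"
    and "r = drop k (take l c)" and "s = drop l c"
  have take_append: "take m c @ drop m (take n c) = take n c" if "m < n" for m n
    using that append_take_drop_id[of m "take n c"] by (simp add: min_def)
  have "take i c @ p @ q @ r @ s = ((take i c @ p) @ q) @ r @ s"
    by simp
  also have "\<dots> = c"
    using indices by (simp only: p_def q_def r_def s_def take_append append_assoc[symmetric]
        append_take_drop_id)
  finally have "vcycle (p @ q @ r @ s @ take i c) G"
    using assms(1) vcycle_append_commute[of "take i c" "p @ q @ r @ s" G] by simp
  moreover have "hd p = c ! i" "hd q = c ! j" "hd r = c ! k" "hd (s @ take i c) = c ! l"
    using indices by (simp_all add: p_def q_def r_def s_def hd_drop_conv_nth)
  moreover have "p \<noteq> []" "q \<noteq> []" "r \<noteq> []" "s \<noteq> []"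
    using indices by (simp_all add: p_def q_def r_def s_def)
  ultimately show thesis
    using chords that[of p q r "s @ take i c"] by simp
qed

lemma (in sym_digraph) vcycle_chord:
  assumes "vcycle (p @ q @ r) G" "p \<noteq> []" "q \<noteq> []" "r \<noteq> []" "hd p \<rightarrow>\<^bsub>G\<^esub> hd r"
  shows "vcycle (p @ q @ [hd r]) G"
proof -
  have "vpath [hd r] G" "hd r \<rightarrow>\<^bsub>G\<^esub> hd p"
    using assms(5) adj_in_verts(2) dominates_sym by (auto simp: vpath_singleton_iff)
  moreover have "3 \<le> length (p @ q @ [hd r])"
    using assms(2,3) by (cases p; cases q) auto
  ultimately show ?thesis
    using assms hd_in_set[OF assms(4)] by (auto simp: vcycle_def vpath_append_iff)
qed

lemma (in sym_digraph) vcycle_crossing_chords: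
  assumes "vcycle (p @ q @ r @ s) G" "p \<noteq> []" "q \<noteq> []" "r \<noteq> []" "s \<noteq> []"
    and "hd p \<rightarrow>\<^bsub>G\<^esub> hd r" "hd q \<rightarrow>\<^bsub>G\<^esub> hd s"
  shows "vcycle (p @ hd q # hd s # rev r) G"
proof -
  have paths: "vpath p G" "vpath r G" "last p \<rightarrow>\<^bsub>G\<^esub> hd q" "last r \<rightarrow>\<^bsub>G\<^esub> hd s"
    and disjoint: "set p \<inter> (set q \<union> set r \<union> set s) = {}" "set q \<inter> (set r \<union> set s) = {}"
      "set r \<inter> set s = {}"
    using assms by (auto simp: vcycle_def vpath_append_iff)
  have hd_q: "hd q \<notin> set p" "hd q \<noteq> hd s" "hd q \<notin> set r" and hd_s: "hd s \<notin> set p" "hd s \<notin> set r"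
    using disjoint hd_in_set[OF assms(3)] hd_in_set[OF assms(5)] by auto
  have "vpath (hd s # rev r) G"
    using paths(2,4) hd_s(2) assms(4,7) adj_in_verts(2) dominates_sym
    by (auto simp: vpath_Cons_iff vpath_rev_iff hd_rev)
  then have "vpath (hd q # hd s # rev r) G"
    using hd_q(2,3) assms(7) adj_in_verts(1) by (auto simp: vpath_Cons_iff)
  then have "vpath (p @ hd q # hd s # rev r) G"
    using paths(1,3) disjoint(1) hd_q(1) hd_s(1) assms(2) by (auto simp: vpath_append_iff)
  moreover have "hd r \<rightarrow>\<^bsub>G\<^esub> hd p"
    using assms(6) dominates_sym by blast
  ultimately show ?thesis
    using assms(2,4) by (auto simp: vcycle_def last_rev Suc_le_eq)
qed

lemma crossing_chords_mod_4:
  fixes p q r s :: nat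
  assumes cycle: "(p + q + r + s) mod 4 \<in> {1, 2}"
    and one_chord: "(p + q + 1) mod 4 \<in> {1, 2}" "(q + r + 1) mod 4 \<in> {1, 2}"
      "(r + s + 1) mod 4 \<in> {1, 2}" "(s + p + 1) mod 4 \<in> {1, 2}"
    and two_chords: "(p + r + 2) mod 4 \<in> {1, 2}" "(q + s + 2) mod 4 \<in> {1, 2}"
  shows False
proof -
  have residue_0_3: "n mod 4 \<in> {0, 3}" if "(n + 2) mod 4 \<in> {1, 2}" for n :: nat
    using that unfolding insert_iff empty_iff by presburger
  have residue_0_1: "n mod 4 \<in> {0, 1}" if "(n + 1) mod 4 \<in> {1, 2}" for n :: nat
    using that unfolding insert_iff empty_iff by presburger
  have odd_residue: "odd n" if "n mod 4 = 1 \<or> n mod 4 = 3" for n :: nat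
    using that by presburger
  have "(p + r) mod 4 = 3" "(q + s) mod 4 = 3"
    using residue_0_3[OF two_chords(1)] residue_0_3[OF two_chords(2)] cycle
      mod_add_eq[of "p + r" 4 "q + s"] by (auto simp: ac_simps)
  then have total_mod_4: "(p + q + r + s) mod 4 = 2"
    using mod_add_eq[of "p + r" 4 "q + s"] by (simp add: ac_simps)
  have "(p + q) mod 4 = 1"
    using residue_0_1[OF one_chord(1)] residue_0_1[OF one_chord(3)] total_mod_4
      mod_add_eq[of "p + q" 4 "r + s"] by (auto simp: ac_simps)
  moreover have "(q + r) mod 4 = 1"
    using residue_0_1[OF one_chord(2)] residue_0_1[OF one_chord(4)] total_mod_4
      mod_add_eq[of "q + r" 4 "s + p"] by (auto simp: ac_simps)
  ultimately have "odd (p + q)" "odd (q + r)" "odd (p + r)"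
    using \<open>(p + r) mod 4 = 3\<close> odd_residue by blast+
  then show False
    by simp
qed

lemma (in sym_digraph) crossing_chords_imp_vcycle_mod_4:
  assumes "vcycle c G" "has_crossing_chords c G"
  shows "\<exists>d. vcycle d G \<and> length d mod 4 \<notin> {1, 2}"
proof (rule ccontr)
  assume "\<nexists>d. vcycle d G \<and> length d mod 4 \<notin> {1, 2}"
  then have mod_4: "length d mod 4 \<in> {1, 2}" if "vcycle d G" for d
    using that by blast
  obtain p q r s where cycle_pqrs: "vcycle (p @ q @ r @ s) G"
    and nonempty: "p \<noteq> []" "q \<noteq> []" "r \<noteq> []" "s \<noteq> []"
    and chords: "hd p \<rightarrow>\<^bsub>G\<^esub> hd r" "hd q \<rightarrow>\<^bsub>G\<^esub> hd s"
    using assms by (rule vcycle_crossing_chordsE)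
  have cycle_qrsp: "vcycle (q @ r @ s @ p) G" and cycle_rspq: "vcycle (r @ s @ p @ q) G"
    and cycle_spqr: "vcycle (s @ p @ q @ r) G"
    using cycle_pqrs vcycle_append_commute[of _ _ G] by (metis append.assoc)+
  have chords_rev: "hd r \<rightarrow>\<^bsub>G\<^esub> hd p" "hd s \<rightarrow>\<^bsub>G\<^esub> hd q"
    using chords dominates_sym by blast+
  show False
  proof (rule crossing_chords_mod_4)
    show "(length p + length q + length r + length s) mod 4 \<in> {1, 2}"
      using mod_4[OF cycle_pqrs] by (simp add: add.assoc)
    show "(length p + length q + 1) mod 4 \<in> {1, 2}"
      using mod_4[OF vcycle_chord[OF cycle_pqrs]] nonempty chords by simp
    show "(length q + length r + 1) mod 4 \<in> {1, 2}"
      using mod_4[OF vcycle_chord[OF cycle_qrsp]] nonempty chords by simp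
    show "(length r + length s + 1) mod 4 \<in> {1, 2}"
      using mod_4[OF vcycle_chord[OF cycle_rspq]] nonempty chords_rev by simp
    show "(length s + length p + 1) mod 4 \<in> {1, 2}"
      using mod_4[OF vcycle_chord[OF cycle_spqr]] nonempty chords_rev by simp
    show "(length p + length r + 2) mod 4 \<in> {1, 2}"
      using mod_4[OF vcycle_crossing_chords[OF cycle_pqrs]] nonempty chords by simp
    show "(length q + length s + 2) mod 4 \<in> {1, 2}"
      using mod_4[OF vcycle_crossing_chords[OF cycle_qrsp]] nonempty chords chords_rev by simp
  qed
qed

lemma (in sym_digraph) vpath_chords_imp_crossing_chords_le:
  assumes "vpath p G" "2 \<le> a" "a < c" "c \<le> b" "b < length p"
    and "p ! 0 \<rightarrow>\<^bsub>G\<^esub> p ! a" "p ! (a - 1) \<rightarrow>\<^bsub>G\<^esub> p ! c" "p ! 0 \<rightarrow>\<^bsub>G\<^esub> p ! b"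
  shows "\<exists>d. vcycle d G \<and> has_crossing_chords d G"
proof -
  define d where "d = take (Suc b) p"
  have "p \<noteq> []" "d \<noteq> []"
    using assms by (auto simp: d_def)
  have "vwalk d G"
    using assms(1) vwalkI_append_l[of d "drop (Suc b) p" G] \<open>d \<noteq> []\<close> by (auto simp: d_def)
  then have "vpath d G"
    using assms(1) by (auto simp: d_def vpath_def)
  moreover have "hd d = p ! 0" "last d = p ! b"
    using assms \<open>p \<noteq> []\<close> \<open>d \<noteq> []\<close> by (simp_all add: d_def hd_conv_nth last_conv_nth)
  ultimately have "vcycle d G"
    using assms dominates_sym by (auto simp: vcycle_def d_def)
  have "0 < a - 1 \<and> a - 1 < a \<and> a < c \<and> c < length d \<and> d ! 0 \<rightarrow>\<^bsub>G\<^esub> d ! a \<and> d ! (a - 1) \<rightarrow>\<^bsub>G\<^esub> d ! c"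
    using assms by (simp add: d_def)
  then have "has_crossing_chords d G"
    unfolding has_crossing_chords_def by blast
  with \<open>vcycle d G\<close> show ?thesis
    by blast
qed

lemma (in sym_digraph) vpath_chords_imp_crossing_chords:
  assumes path: "vpath p G" and indices: "2 \<le> a" "a < b" "b < length p" "a < c" "c < length p"
    and chords: "p ! 0 \<rightarrow>\<^bsub>G\<^esub> p ! a" "p ! 0 \<rightarrow>\<^bsub>G\<^esub> p ! b" "p ! (a - 1) \<rightarrow>\<^bsub>G\<^esub> p ! c"
  shows "\<exists>d. vcycle d G \<and> has_crossing_chords d G"
proof (cases "c \<le> b")
  case True
  then show ?thesis
    using vpath_chords_imp_crossing_chords_le[of p a c b] assms by blast
next
  case False
  let ?q = "rev_prefix a p"
  have "p \<noteq> []"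
    using indices(3) by auto
  then have q_nth: "?q ! 0 = p ! (a - 1)" "?q ! (a - 1) = p ! 0" "?q ! a = p ! a" "?q ! b = p ! b"
    "?q ! c = p ! c"
    using indices by (simp_all add: nth_rev_prefix)
  have "vpath ?q G"
    using vpath_rev_prefix path indices(2,3) chords(1) by auto
  moreover have "?q ! 0 \<rightarrow>\<^bsub>G\<^esub> ?q ! a"
    using vpath_nth_dominates[OF path, of "a - 1"] indices(1-3) q_nth by simp
  moreover have "?q ! (a - 1) \<rightarrow>\<^bsub>G\<^esub> ?q ! b" "?q ! 0 \<rightarrow>\<^bsub>G\<^esub> ?q ! c"
    using chords(2,3) q_nth by simp_all
  ultimately show ?thesis
    using vpath_chords_imp_crossing_chords_le[of ?q a b c] False indices by simp
qed

subsection \<open>Longest paths\<close>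

definition longest_vpath :: "'a vwalk \<Rightarrow> ('a, 'b) pre_digraph \<Rightarrow> bool" where
  "longest_vpath p G \<longleftrightarrow> vpath p G \<and> (\<forall>q. vpath q G \<longrightarrow> length q \<le> length p)"

lemma (in fin_digraph) ex_longest_vpath:
  assumes "verts G \<noteq> {}"
  shows "\<exists>p. longest_vpath p G"
proof -
  obtain v where "vpath [v] G"
    using assms by (auto simp: vpath_singleton_iff)
  moreover have "length p < Suc (card (verts G))" if "vpath p G" for p
    using that card_mono[OF finite_verts, of "set p"]
    by (auto simp: vpath_def vwalk_def distinct_card less_Suc_eq_le)
  ultimately show ?thesis
    unfolding longest_vpath_def by (intro ex_has_greatest_nat) auto
qed

lemma (in sym_digraph) longest_vpath_dominates_in_set:
  assumes "longest_vpath p G" "hd p \<rightarrow>\<^bsub>G\<^esub> v"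
  shows "v \<in> set p"
proof (rule ccontr)
  assume "v \<notin> set p"
  then have "vpath (v # p) G"
    using assms dominates_sym vwalk_wf_digraph_consI[of p v]
    by (auto simp: longest_vpath_def vpath_def)
  then show False
    using assms(1) by (auto simp: longest_vpath_def)
qed

lemma (in sym_digraph) longest_vpath_rev_prefix:
  assumes "longest_vpath p G" "n < length p" "p ! 0 \<rightarrow>\<^bsub>G\<^esub> p ! n"
  shows "longest_vpath (rev_prefix n p) G"
  using assms by (simp add: longest_vpath_def vpath_rev_prefix)

lemma (in nomulti_digraph) out_degree_eq_card_dominated:
  "out_degree G u = card {v. u \<rightarrow>\<^bsub>G\<^esub> v}"
proof -
  have "inj_on (head G) (out_arcs G u)"
    by (rule inj_onI) (auto intro!: no_multi_arcs simp: arc_to_ends_def)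
  moreover have "head G ` out_arcs G u = {v. u \<rightarrow>\<^bsub>G\<^esub> v}"
    by (auto simp: arcs_ends_conv)
  ultimately show ?thesis
    unfolding out_degree_def by (metis card_image)
qed

lemma (in graph) longest_vpath_ex_chord:
  assumes longest: "longest_vpath p G" and degree: "3 \<le> out_degree G (p ! 0)"
  shows "\<exists>i. 2 \<le> i \<and> i \<noteq> j \<and> i < length p \<and> p ! 0 \<rightarrow>\<^bsub>G\<^esub> p ! i"
proof -
  have "p \<noteq> []"
    using longest by (auto simp: longest_vpath_def)
  have "card {p ! 1, p ! j} \<le> 2"
    by (simp add: card_insert_if)
  then have "\<not> {v. p ! 0 \<rightarrow>\<^bsub>G\<^esub> v} \<subseteq> {p ! 1, p ! j}"
    using degree card_mono[of "{p ! 1, p ! j}" "{v. p ! 0 \<rightarrow>\<^bsub>G\<^esub> v}"]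
    by (auto simp: out_degree_eq_card_dominated)
  then obtain v where neighbour: "p ! 0 \<rightarrow>\<^bsub>G\<^esub> v" "v \<noteq> p ! 1" "v \<noteq> p ! j"
    by blast
  then have "v \<in> set p"
    using longest_vpath_dominates_in_set[OF longest] \<open>p \<noteq> []\<close> by (simp add: hd_conv_nth)
  then obtain i where position: "i < length p" "v = p ! i"
    by (auto simp: in_set_conv_nth)
  have "i \<noteq> 0"
    using adj_not_same neighbour(1) position(2) by metis
  moreover have "i \<noteq> 1" "i \<noteq> j"
    using neighbour position(2) by auto
  ultimately show ?thesis
    using neighbour(1) position by (intro exI[of _ i]) auto
qed

lemma (in graph) ex_longest_vpath_least_chord:
  assumes "verts G \<noteq> {}" and min_degree: "\<And>v. v \<in> verts G \<Longrightarrow> 3 \<le> out_degree G v"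
  shows "\<exists>p a. longest_vpath p G \<and> 2 \<le> a \<and> a < length p \<and> p ! 0 \<rightarrow>\<^bsub>G\<^esub> p ! a \<and>
    (\<forall>q. longest_vpath q G \<longrightarrow> (\<exists>i>a. i < length q \<and> q ! 0 \<rightarrow>\<^bsub>G\<^esub> q ! i))"
proof -
  have degree: "3 \<le> out_degree G (q ! 0)" if "longest_vpath q G" for q
    using that by (cases q) (auto simp: longest_vpath_def vpath_def vwalk_def min_degree)
  define chord_end where "chord_end i \<longleftrightarrow>
    (\<exists>p. longest_vpath p G \<and> 2 \<le> i \<and> i < length p \<and> p ! 0 \<rightarrow>\<^bsub>G\<^esub> p ! i)" for i
  define a where "a = (LEAST i. chord_end i)"
  have "\<exists>i. chord_end i"
    using ex_longest_vpath[OF assms(1)] longest_vpath_ex_chord degree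
    unfolding chord_end_def by meson
  then have "chord_end a"
    unfolding a_def by (rule LeastI_ex)
  then obtain p where "longest_vpath p G" "2 \<le> a" "a < length p" "p ! 0 \<rightarrow>\<^bsub>G\<^esub> p ! a"
    unfolding chord_end_def by blast
  moreover have "\<exists>i>a. i < length q \<and> q ! 0 \<rightarrow>\<^bsub>G\<^esub> q ! i" if longest: "longest_vpath q G" for q
  proof -
    obtain i where chord: "2 \<le> i" "i \<noteq> a" "i < length q" "q ! 0 \<rightarrow>\<^bsub>G\<^esub> q ! i"
      using longest_vpath_ex_chord[OF longest degree[OF longest]] by blast
    then have "a \<le> i"
      using longest unfolding a_def chord_end_def by (intro Least_le) auto
    with chord show ?thesis
      by (intro exI[of _ i]) auto
  qed
  ultimately show ?thesis
    by blast
qed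

lemma (in graph) min_degree_3_imp_crossing_chords:
  assumes "verts G \<noteq> {}" "\<And>v. v \<in> verts G \<Longrightarrow> 3 \<le> out_degree G v"
  shows "\<exists>c. vcycle c G \<and> has_crossing_chords c G"
proof -
  obtain p a where longest: "longest_vpath p G"
    and chord_a: "2 \<le> a" "a < length p" "p ! 0 \<rightarrow>\<^bsub>G\<^esub> p ! a"
    and later_chord: "\<And>q. longest_vpath q G \<Longrightarrow> \<exists>i>a. i < length q \<and> q ! 0 \<rightarrow>\<^bsub>G\<^esub> q ! i"
    using ex_longest_vpath_least_chord[OF assms] by blast
  obtain b where chord_b: "a < b" "b < length p" "p ! 0 \<rightarrow>\<^bsub>G\<^esub> p ! b"
    using later_chord[OF longest] by blast
  have "longest_vpath (rev_prefix a p) G"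
    using longest chord_a(2,3) by (rule longest_vpath_rev_prefix)
  then obtain c where chord_c: "a < c" "c < length p" "rev_prefix a p ! 0 \<rightarrow>\<^bsub>G\<^esub> rev_prefix a p ! c"
    using later_chord by fastforce
  have "p \<noteq> []"
    using chord_a(2) by auto
  then have "rev_prefix a p ! 0 = p ! (a - 1)" "rev_prefix a p ! c = p ! c"
    using chord_a(1,2) chord_c(1,2) by (simp_all add: nth_rev_prefix)
  then show ?thesis
    using vpath_chords_imp_crossing_chords[of p a b c] longest chord_a chord_b chord_c
    by (simp add: longest_vpath_def)
qed

lemma (in graph) ex_out_degree_le_2:
  assumes "verts G \<noteq> {}" and type_1_2: "\<And>p. ucycle G p \<Longrightarrow> length p mod 4 \<in> {1, 2}"
  shows "\<exists>v \<in> verts G. out_degree G v \<le> 2"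
proof (rule ccontr)
  assume "\<not> ?thesis"
  then have "3 \<le> out_degree G v" if "v \<in> verts G" for v
    using that by (simp add: not_le numeral_3_eq_3 numeral_2_eq_2 Suc_le_eq)
  then obtain c where "vcycle c G" "has_crossing_chords c G"
    using min_degree_3_imp_crossing_chords assms(1) by blast
  then obtain d where "vcycle d G" "length d mod 4 \<notin> {1, 2}"
    using crossing_chords_imp_vcycle_mod_4 by blast
  then show False
    using vcycle_imp_ucycle[of d] type_1_2 by force
qed

lemma (in graph) connected_out_degree_ne_0:
  assumes "connected G" "arcs G \<noteq> {}" "u \<in> verts G"
  shows "out_degree G u \<noteq> 0"
proof -
  obtain e where "e \<in> arcs G"
    using assms(2) by blast
  then obtain v where "v \<in> verts G" "v \<noteq> u"
    using no_loops head_in_verts tail_in_verts by metis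
  then have "u \<rightarrow>\<^sup>*\<^bsub>G\<^esub> v"
    using symmetric_connected_imp_strongly_connected[OF sym_arcs assms(1)] assms(3) by auto
  then obtain w where "u \<rightarrow>\<^bsub>G\<^esub> w"
    using \<open>v \<noteq> u\<close> by (metis converse_reachable_cases)
  then have "out_arcs G u \<noteq> {}"
    by (auto simp: arcs_ends_conv)
  then show ?thesis
    using finite_out_arcs by (simp add: out_degree_def)
qed

theorem theorem18:
  fixes G :: "('a, 'b) pre_digraph"
  assumes "G \<in> epsilon12"
  shows "\<exists>v \<in> verts G. out_degree G v = 2"
proof -
  have "graph G" "connected G" and even_degree: "\<And>v. v \<in> verts G \<Longrightarrow> even (out_degree G v)"
    and type_1_2: "\<And>p. ucycle G p \<Longrightarrow> length p mod 4 \<in> {1, 2}"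
    and "\<exists>p. ucycle G p"
    using assms by (auto simp: epsilon12_def euler_graph_def cycle_of_type_def)
  interpret graph G by fact
  have "arcs G \<noteq> {}"
    using \<open>\<exists>p. ucycle G p\<close> by (auto simp: ucycle_def cycle_def awalk_def)
  then have "verts G \<noteq> {}"
    using tail_in_verts by blast
  then obtain v where "v \<in> verts G" "out_degree G v \<le> 2"
    using ex_out_degree_le_2 type_1_2 by blast
  moreover have "out_degree G v \<noteq> 0"
    using \<open>connected G\<close> \<open>arcs G \<noteq> {}\<close> \<open>v \<in> verts G\<close> by (rule connected_out_degree_ne_0)
  ultimately have "out_degree G v = 2"
    using even_degree[of v] by presburger
  with \<open>v \<in> verts G\<close> show ?thesis
    by blast
qed

end
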